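(* Let $G_1=(V_1,E_1)$ and $G_2=(V_2,E_2)$ be two labeled graphs, and let $C_E$ be the edit cost function with vertex insertion cost $0$, vertex deletion cost $0$, vertex relabeling cost $\infty$, edge insertion cost $1$, edge deletion cost $1$, and edge relabeling cost $2$. Then \[ \mathrm{GED}(G_1,G_2;C_E) = |E_1|+|E_2|-2\,\mathrm{MCES}(G_1,G_2). \]
   Context: Graphs are finite, simple and undirected. A labeled graph is a graph $G=(V,E)$ with a labeling function $\ell\colon V\cup E\to\Sigma$, where $\Sigma$ is a finite alphabet. Two labeled graphs are isomorphic if there is a bijection between their vertex sets that preserves adjacency and non-adjacency, vertex labels, and edge labels. Graph edit distance. An edit operation is an insertion, deletion, or relabeling of a vertex or an edge. Each operation has a non-negative cost given by a cost function $C$; the cost functions considered have constant insertion and deletion costs, and a constant relabeling cost charged when the labels do not match (leaving a label unchanged costs $0$). An edit path $\gamma=(o_1,\dots,o_k)$ from $G_1$ to $G_2$ is a sequence of edit operations transforming $G_1$ into a graph isomorphic to $G_2$, with cost $C(\gamma)=\sum_i C(o_i)$. A restricted edit path is an edit path in which a vertex can only be deleted after its incident edges have been deleted, an edge can only be inserted if its endpoints exist, each vertex and each edge is edited at most once, and deleting and reinserting an edge between relabeled (i.e. substituted) vertices is forbidden. Then $\mathrm{GED}(G_1,G_2;C)=\min_{\gamma} C(\gamma)$, where $\gamma$ ranges over all restricted edit paths from $G_1$ to $G_2$. It is a known fact that this is equivalent to the node map formulation: the minimum, over all bijections $\phi$ from a subset $U_1\subseteq V_1$ to a subset $U_2\subseteq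 V_2$, of the total induced cost, where vertices in $U_1$ are mapped (relabeled if the labels differ), vertices of $V_1\setminus U_1$ are deleted, vertices of $V_2\setminus U_2$ are inserted, an edge $(u,v)\in E_1$ with $u,v\in U_1$ and $(\phi(u),\phi(v))\in E_2$ is kept (relabeled if the labels differ), all other edges of $E_1$ are deleted, and all other edges of $E_2$ are inserted. Maximum common edge subgraph. A common subgraph of $G_1$ and $G_2$ is a (not necessarily induced, not necessarily connected) subgraph of $G_1$ that is isomorphic, as a labeled graph, to a subgraph of $G_2$. $\mathrm{MCES}(G_1,G_2)$ is the maximum number of edges in a common subgraph of $G_1$ and $G_2$. *)

theory Defs
  imports Complex_Main "HOL-Library.Extended_Real" "HOL-Library.Infinite_Typeclass"
begin

text \<open>Edges are two-element vertex sets. The labelling of \<open>V \<union> E\<close> is split into two functions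
  with values in the common alphabet \<open>'l\<close>; their values outside of \<open>V\<close> and \<open>E\<close> are irrelevant.\<close>

record ('v, 'l) lgraph =
  verts :: "'v set"
  edges :: "'v set set"
  vlab :: "'v \<Rightarrow> 'l"
  elab :: "'v set \<Rightarrow> 'l"

definition labeled_graph :: "('v, 'l) lgraph \<Rightarrow> bool" where
  "labeled_graph G \<longleftrightarrow> finite (verts G) \<and> (\<forall>e\<in>edges G. e \<subseteq> verts G \<and> card e = 2)"

definition isomorphic :: "('v, 'l) lgraph \<Rightarrow> ('w, 'l) lgraph \<Rightarrow> bool" where
  "isomorphic G H \<longleftrightarrow> (\<exists>f. bij_betw f (verts G) (verts H)
     \<and> (\<forall>u\<in>verts G. \<forall>v\<in>verts G. {u, v} \<in> edges G \<longleftrightarrow> {f u, f v} \<in> edges H)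
     \<and> (\<forall>v\<in>verts G. vlab H (f v) = vlab G v)
     \<and> (\<forall>e\<in>edges G. elab H (f ` e) = elab G e))"

definition subgraph :: "('v, 'l) lgraph \<Rightarrow> ('v, 'l) lgraph \<Rightarrow> bool" where
  "subgraph H G \<longleftrightarrow> labeled_graph H \<and> verts H \<subseteq> verts G \<and> edges H \<subseteq> edges G
     \<and> (\<forall>v\<in>verts H. vlab H v = vlab G v) \<and> (\<forall>e\<in>edges H. elab H e = elab G e)"

definition common_subgraph ::
    "('v, 'l) lgraph \<Rightarrow> ('v, 'l) lgraph \<Rightarrow> ('w, 'l) lgraph \<Rightarrow> bool" where
  "common_subgraph H G1 G2 \<longleftrightarrow> subgraph H G1 \<and> (\<exists>K. subgraph K G2 \<and> isomorphic H K)"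

definition mces :: "('v, 'l) lgraph \<Rightarrow> ('w, 'l) lgraph \<Rightarrow> nat" where
  "mces G1 G2 = Max {card (edges H) | H. common_subgraph H G1 G2}"

datatype ('v, 'l) edit_op =
    Ins_V 'v 'l | Del_V 'v | Rel_V 'v 'l
  | Ins_E "'v set" 'l | Del_E "'v set" | Rel_E "'v set" 'l

fun apply_op :: "('v, 'l) lgraph \<Rightarrow> ('v, 'l) edit_op \<Rightarrow> ('v, 'l) lgraph" where
  "apply_op G (Ins_V v l) = G\<lparr>verts := insert v (verts G), vlab := (vlab G)(v := l)\<rparr>"
| "apply_op G (Del_V v) = G\<lparr>verts := verts G - {v}\<rparr>"
| "apply_op G (Rel_V v l) = G\<lparr>vlab := (vlab G)(v := l)\<rparr>"
| "apply_op G (Ins_E e l) = G\<lparr>edges := insert e (edges G), elab := (elab G)(e := l)\<rparr>"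
| "apply_op G (Del_E e) = G\<lparr>edges := edges G - {e}\<rparr>"
| "apply_op G (Rel_E e l) = G\<lparr>elab := (elab G)(e := l)\<rparr>"

text \<open>The conditions for \<open>Del_V\<close> and \<open>Ins_E\<close> include the requirements of restricted edit paths
  that the incident edges are deleted before a vertex and that an inserted edge has both of its
  endpoints.\<close>

fun applicable :: "('v, 'l) lgraph \<Rightarrow> ('v, 'l) edit_op \<Rightarrow> bool" where
  "applicable G (Ins_V v l) \<longleftrightarrow> v \<notin> verts G"
| "applicable G (Del_V v) \<longleftrightarrow> v \<in> verts G \<and> (\<forall>e\<in>edges G. v \<notin> e)"
| "applicable G (Rel_V v l) \<longleftrightarrow> v \<in> verts G"
| "applicable G (Ins_E e l) \<longleftrightarrow> e \<notin> edges G \<and> e \<subseteq> verts G \<and> card e = 2"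
| "applicable G (Del_E e) \<longleftrightarrow> e \<in> edges G"
| "applicable G (Rel_E e l) \<longleftrightarrow> e \<in> edges G"

fun applicable_path :: "('v, 'l) lgraph \<Rightarrow> ('v, 'l) edit_op list \<Rightarrow> bool" where
  "applicable_path G [] \<longleftrightarrow> True"
| "applicable_path G (x # xs) \<longleftrightarrow> applicable G x \<and> applicable_path (apply_op G x) xs"

fun edited :: "('v, 'l) edit_op \<Rightarrow> 'v + 'v set" where
  "edited (Ins_V v l) = Inl v"
| "edited (Del_V v) = Inl v"
| "edited (Rel_V v l) = Inl v"
| "edited (Ins_E e l) = Inr e"
| "edited (Del_E e) = Inr e"
| "edited (Rel_E e l) = Inr e"

text \<open>The substituted vertices are those vertices of the source graph that are not deleted.
  Vertices and edges are identified by name, so the last conjunct (no edge between substituted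
  vertices is deleted and reinserted) already follows from the distinctness condition.\<close>

definition restricted_edit_path ::
    "('v, 'l) lgraph \<Rightarrow> ('w, 'l) lgraph \<Rightarrow> ('v, 'l) edit_op list \<Rightarrow> bool" where
  "restricted_edit_path G1 G2 p \<longleftrightarrow>
     applicable_path G1 p \<and> isomorphic (foldl apply_op G1 p) G2
     \<and> distinct (map edited p)
     \<and> (\<forall>e. e \<subseteq> {v \<in> verts G1. Del_V v \<notin> set p} \<longrightarrow>
          \<not> (Del_E e \<in> set p \<and> (\<exists>l. Ins_E e l \<in> set p)))"

record edit_cost =
  vins :: ereal
  vdel :: ereal
  vrel :: ereal
  eins :: ereal
  edel :: ereal
  erel :: ereal

fun op_cost :: "edit_cost \<Rightarrow> ('v, 'l) lgraph \<Rightarrow> ('v, 'l) edit_op \<Rightarrow> ereal" where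
  "op_cost C G (Ins_V v l) = vins C"
| "op_cost C G (Del_V v) = vdel C"
| "op_cost C G (Rel_V v l) = (if vlab G v = l then 0 else vrel C)"
| "op_cost C G (Ins_E e l) = eins C"
| "op_cost C G (Del_E e) = edel C"
| "op_cost C G (Rel_E e l) = (if elab G e = l then 0 else erel C)"

fun path_cost :: "edit_cost \<Rightarrow> ('v, 'l) lgraph \<Rightarrow> ('v, 'l) edit_op list \<Rightarrow> ereal" where
  "path_cost C G [] = 0"
| "path_cost C G (x # xs) = op_cost C G x + path_cost C (apply_op G x) xs"

text \<open>Inserted vertices are taken from the vertex type of the source graph, which has to be
  infinite so that fresh vertices are always available. The minimum is written with \<open>LEAST\<close>,
  so computing the distance requires exhibiting a path that attains it.\<close>

definition ged ::
    "edit_cost \<Rightarrow> ('v::infinite, 'l) lgraph \<Rightarrow> ('w, 'l) lgraph \<Rightarrow> ereal" where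
  "ged C G1 G2 = (LEAST c. \<exists>p. restricted_edit_path G1 G2 p \<and> c = path_cost C G1 p)"

definition C_E :: edit_cost where
  "C_E = \<lparr>vins = 0, vdel = 0, vrel = \<infinity>, eins = 1, edel = 1, erel = 2\<rparr>"

end

theory Submission
  imports Defs
begin

text \<open>For \<open>C_E\<close>, a vertex costs nothing as long as its label is kept, and an edge operation costs
  exactly the change it makes to the set of labelled edges, measured by the cardinality of the
  symmetric difference. Hence, by the triangle inequality, a path from \<open>G1\<close> to \<open>G'\<close> of finite cost
  costs at least \<open>card (edges G1) + card (edges G') - 2 * k\<close>, where \<open>k\<close> is the number of labelled
  edges shared by \<open>G1\<close> and \<open>G'\<close>. These form a common subgraph, since surviving vertices have kept
  their labels. Conversely, a maximum common subgraph embeds a copy \<open>G'\<close> of \<open>G2\<close> into the vertex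
  type of \<open>G1\<close>, completed by fresh vertices. Removing the discrepancies between \<open>G1\<close> and \<open>G'\<close> one
  by one attains the bound.\<close>

text \<open>Pairing an edge with its label turns a proper relabelling into a change of two elements,
  which matches the cost 2 of \<open>erel C_E\<close>.\<close>

definition lab_edges :: "('v, 'l) lgraph \<Rightarrow> ('v set \<times> 'l) set" where
  "lab_edges G = (\<lambda>e. (e, elab G e)) ` edges G"

text \<open>These are the first components of the pairs in
  \<open>lab_edges A \<inter> lab_edges B\<close>. As plain edges they can serve as the edge set of
  a subgraph.\<close>

definition shared_edges :: "('v, 'l) lgraph \<Rightarrow> ('v, 'l) lgraph \<Rightarrow> 'v set set" where
  "shared_edges A B = {e \<in> edges A \<inter> edges B. elab A e = elab B e}"

lemma finite_edges: "labeled_graph G \<Longrightarrow> finite (edges G)"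
  unfolding labeled_graph_def by (rule finite_subset[of _ "Pow (verts G)"]) auto

lemma edge_endpoints:
  assumes "labeled_graph G" "e \<in> edges G"
  obtains u v where "e = {u, v}" "u \<in> verts G" "v \<in> verts G"
proof -
  have "card e = 2" "e \<subseteq> verts G" using assms by (auto simp: labeled_graph_def)
  then obtain u v where "e = {u, v}" unfolding card_2_iff by metis
  with \<open>e \<subseteq> verts G\<close> show ?thesis by (intro that) auto
qed

lemma finite_lab_edges: "labeled_graph G \<Longrightarrow> finite (lab_edges G)"
  by (simp add: lab_edges_def finite_edges)

lemma card_lab_edges: "card (lab_edges G) = card (edges G)"
  unfolding lab_edges_def by (rule card_image) (auto intro: inj_onI)

lemma mem_lab_edges: "(e, l) \<in> lab_edges G \<longleftrightarrow> e \<in> edges G \<and> elab G e = l"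
  by (auto simp: lab_edges_def)

section \<open>Cardinalities of symmetric differences\<close>

lemma card_sym_diff:
  assumes "finite A" "finite B"
  shows "real (card (sym_diff A B)) = real (card A) + real (card B) - 2 * real (card (A \<inter> B))"
proof -
  have "(A - B) \<inter> (B - A) = {}" by blast
  then have "card (sym_diff A B) = card (A - B) + card (B - A)"
    by (intro card_Un_disjoint finite_Diff assms)
  moreover have "card A = card (A \<inter> B) + card (A - B)"
    by (rule card_Int_Diff[OF assms(1)])
  moreover have "card B = card (A \<inter> B) + card (B - A)"
    by (subst Int_commute) (rule card_Int_Diff[OF assms(2)])
  ultimately show ?thesis by linarith
qed

lemma card_sym_diff_triangle:
  assumes "finite A" "finite B" "finite C"
  shows "card (sym_diff A C) \<le> card (sym_diff A B) + card (sym_diff B C)"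
proof -
  have "sym_diff A C \<subseteq> sym_diff A B \<union> sym_diff B C" by blast
  then have "card (sym_diff A C) \<le> card (sym_diff A B \<union> sym_diff B C)"
    by (intro card_mono finite_UnI finite_Diff assms)
  also have "\<dots> \<le> card (sym_diff A B) + card (sym_diff B C)"
    by (rule card_Un_le)
  finally show ?thesis .
qed

text \<open>The map \<open>e \<mapsto> (e, elab A e)\<close> is a bijection from the shared edges
  onto the common pairs. For fixed edge counts, sharing more edges thus means a smaller
  distance.\<close>

lemma card_sym_diff_lab_edges:
  assumes "labeled_graph A" "labeled_graph B"
  shows "real (card (sym_diff (lab_edges A) (lab_edges B))) =
    real (card (edges A)) + real (card (edges B)) - 2 * real (card (shared_edges A B))"
proof -
  have "x \<in> lab_edges A \<inter> lab_edges B \<longleftrightarrow> x \<in> (\<lambda>e. (e, elab A e)) ` shared_edges A B" for x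
    by (cases x) (auto simp: mem_lab_edges shared_edges_def image_iff)
  then have "lab_edges A \<inter> lab_edges B = (\<lambda>e. (e, elab A e)) ` shared_edges A B"
    by (rule set_eqI)
  moreover have "inj_on (\<lambda>e. (e, elab A e)) (shared_edges A B)"
    by (simp add: inj_on_def)
  ultimately have "card (lab_edges A \<inter> lab_edges B) = card (shared_edges A B)"
    by (simp only: card_image)
  then show ?thesis
    using card_sym_diff[OF assms[THEN finite_lab_edges]] by (simp only: card_lab_edges)
qed

section \<open>Cost of an arbitrary path\<close>

lemma labeled_graph_apply_op:
  assumes "labeled_graph G" "applicable G x"
  shows "labeled_graph (apply_op G x)"
  using assms by (cases x) (auto simp: labeled_graph_def)

lemma labeled_graph_foldl:
  "labeled_graph G \<Longrightarrow> applicable_path G p \<Longrightarrow> labeled_graph (foldl apply_op G p)"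
  by (induction p arbitrary: G) (auto simp: labeled_graph_apply_op)

text \<open>\<open>Ins_E\<close> overwrites \<open>elab\<close> at \<open>e\<close>; as
  \<open>e\<close> is absent before, no existing pair is lost by this.\<close>

lemma lab_edges_Ins_E:
  "e \<notin> edges G \<Longrightarrow> lab_edges (apply_op G (Ins_E e l)) = insert (e, l) (lab_edges G)"
  by (rule set_eqI) (auto simp: mem_lab_edges split: if_splits)

lemma lab_edges_Del_E:
  "lab_edges (apply_op G (Del_E e)) = lab_edges G - {(e, elab G e)}"
  by (rule set_eqI) (auto simp: mem_lab_edges split: if_splits)

lemma lab_edges_Rel_E:
  "e \<in> edges G \<Longrightarrow>
    lab_edges (apply_op G (Rel_E e l)) = insert (e, l) (lab_edges G - {(e, elab G e)})"
  by (rule set_eqI) (auto simp: mem_lab_edges split: if_splits)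

lemma lab_edges_vertex_op:
  "lab_edges (apply_op G (Ins_V v l)) = lab_edges G"
  "lab_edges (apply_op G (Del_V v)) = lab_edges G"
  "lab_edges (apply_op G (Rel_V v l)) = lab_edges G"
  by (auto simp: lab_edges_def)

lemma op_cost_C_E_nonneg: "0 \<le> op_cost C_E G x"
  by (cases x) (auto simp: C_E_def)

lemma path_cost_C_E_nonneg: "0 \<le> path_cost C_E G p"
  by (induction p arbitrary: G) (auto simp: op_cost_C_E_nonneg)

text \<open>Inserting or deleting an edge affects a single pair at cost 1, and a proper relabelling
  affects at most two pairs at cost 2.\<close>

lemma op_cost_C_E_ge:
  assumes "applicable G x"
  shows "ereal (real (card (sym_diff (lab_edges G) (lab_edges (apply_op G x))))) \<le> op_cost C_E G x"
proof -
  \<comment> \<open>This covers the vertex operations and the relabelling of an edge by its own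
    label; nonnegative cost suffices there.\<close>
  have unchanged: ?thesis if "lab_edges (apply_op G x) = lab_edges G"
    unfolding that using op_cost_C_E_nonneg[of G x] by (simp add: zero_ereal_def)
  show ?thesis
  proof (cases x)
    case (Ins_E e l)
    then have "lab_edges (apply_op G x) = insert (e, l) (lab_edges G)"
      using assms by (simp add: lab_edges_Ins_E del: apply_op.simps)
    then have "sym_diff (lab_edges G) (lab_edges (apply_op G x)) \<subseteq> {(e, l)}"
      by auto
    then have "card (sym_diff (lab_edges G) (lab_edges (apply_op G x))) \<le> card {(e, l)}"
      by (intro card_mono) auto
    then show ?thesis using Ins_E by (simp add: C_E_def del: apply_op.simps)
  next
    case (Del_E e)
    then have "lab_edges (apply_op G x) = lab_edges G - {(e, elab G e)}"
      by (simp only: lab_edges_Del_E)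
    then have "sym_diff (lab_edges G) (lab_edges (apply_op G x)) \<subseteq> {(e, elab G e)}"
      by auto
    then have "card (sym_diff (lab_edges G) (lab_edges (apply_op G x))) \<le> card {(e, elab G e)}"
      by (intro card_mono) auto
    then show ?thesis using Del_E by (simp add: C_E_def del: apply_op.simps)
  next
    case (Rel_E e l)
    show ?thesis
    proof (cases "elab G e = l")
      case True
      then have "apply_op G x = G"
        using Rel_E by auto
      then show ?thesis by (intro unchanged) simp
    next
      case False
      have "lab_edges (apply_op G x) = insert (e, l) (lab_edges G - {(e, elab G e)})"
        using assms Rel_E by (simp add: lab_edges_Rel_E del: apply_op.simps)
      then have "sym_diff (lab_edges G) (lab_edges (apply_op G x)) \<subseteq> {(e, l), (e, elab G e)}"
        by auto
      then have "card (sym_diff (lab_edges G) (lab_edges (apply_op G x))) \<le> card {(e, l), (e, elab G e)}"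
        by (intro card_mono) auto
      also have "\<dots> \<le> 2" by (simp add: card_insert_if)
      finally have "ereal (real (card (sym_diff (lab_edges G) (lab_edges (apply_op G x))))) \<le> ereal 2"
        by simp
      then show ?thesis using Rel_E False by (simp add: C_E_def del: apply_op.simps)
    qed
  next
    case (Ins_V v l)
    show ?thesis by (rule unchanged) (simp only: Ins_V lab_edges_vertex_op)
  next
    case (Del_V v)
    show ?thesis by (rule unchanged) (simp only: Del_V lab_edges_vertex_op)
  next
    case (Rel_V v l)
    show ?thesis by (rule unchanged) (simp only: Rel_V lab_edges_vertex_op)
  qed
qed

lemma path_cost_C_E_ge:
  assumes "labeled_graph G" "applicable_path G p"
  shows "ereal (real (card (sym_diff (lab_edges G) (lab_edges (foldl apply_op G p)))))
    \<le> path_cost C_E G p"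
  using assms
proof (induction p arbitrary: G)
  case Nil
  then show ?case by simp
next
  case (Cons x p)
  let ?G' = "apply_op G x" and ?F = "foldl apply_op G (x # p)"
  let ?d = "\<lambda>A B. real (card (sym_diff (lab_edges A) (lab_edges B)))"
  have G': "labeled_graph ?G'" and F: "labeled_graph ?F"
    using Cons.prems labeled_graph_apply_op labeled_graph_foldl by (fastforce, blast)
  have "?d G ?F \<le> ?d G ?G' + ?d ?G' ?F"
    using card_sym_diff_triangle[OF Cons.prems(1)[THEN finite_lab_edges]
        G'[THEN finite_lab_edges] F[THEN finite_lab_edges]] by linarith
  then have "ereal (?d G ?F) \<le> ereal (?d G ?G') + ereal (?d ?G' ?F)"
    by simp
  also have "\<dots> \<le> op_cost C_E G x + path_cost C_E ?G' p"
    using Cons.prems G' by (intro add_mono op_cost_C_E_ge) (simp_all add: Cons.IH)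
  finally show ?case by simp
qed

lemma untouched_vertex:
  assumes "Inl v \<notin> edited ` set p"
  shows "(v \<in> verts (foldl apply_op G p) \<longleftrightarrow> v \<in> verts G) \<and> vlab (foldl apply_op G p) v = vlab G v"
  using assms
proof (induction p arbitrary: G)
  case (Cons x p)
  then have "(v \<in> verts (apply_op G x) \<longleftrightarrow> v \<in> verts G) \<and> vlab (apply_op G x) v = vlab G v"
    by (cases x) auto
  with Cons show ?case by simp
qed simp

text \<open>Finite cost excludes a proper relabelling. Deleting a vertex and reinserting it under a
  new label would be free, but it edits the same vertex twice and is excluded by
  distinctness.\<close>

lemma surviving_vertex_label:
  assumes "applicable_path G p" "distinct (map edited p)" "path_cost C_E G p < \<infinity>"
    and "v \<in> verts G" "v \<in> verts (foldl apply_op G p)"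
  shows "vlab (foldl apply_op G p) v = vlab G v"
  using assms
proof (induction p arbitrary: G)
  case (Cons x p)
  have fin: "op_cost C_E G x < \<infinity>" "path_cost C_E (apply_op G x) p < \<infinity>"
    using Cons.prems(3) op_cost_C_E_nonneg[of G x] path_cost_C_E_nonneg[of "apply_op G x" p]
    by auto
  show ?case
  proof (cases "edited x = Inl v")
    case True
    then have "Inl v \<notin> edited ` set p" using Cons.prems(2) by auto
    note u = untouched_vertex[OF this, of "apply_op G x"]
    \<comment> \<open>Here \<open>Ins_V\<close> is not applicable, \<open>Del_V\<close> contradicts
      survival because the rest of the path leaves \<open>v\<close> alone, and \<open>Rel_V\<close>
      has finite cost only if it keeps the label.\<close>
    show ?thesis using True u Cons.prems fin
      by (cases x) (auto simp: C_E_def split: if_splits)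
  next
    case False
    then have "v \<in> verts (apply_op G x)" "vlab (apply_op G x) v = vlab G v"
      using Cons.prems(4) by (cases x; auto)+
    then show ?thesis using Cons fin by simp
  qed
qed simp

section \<open>Common subgraphs\<close>

text \<open>Taking images under \<open>f\<close> is a bijection between the edge sets: injectivity
  is inherited from \<open>f\<close> on the vertices, and surjectivity follows by pulling back both
  endpoints.\<close>

lemma isomorphic_card_edges:
  assumes "labeled_graph G" "labeled_graph H" "isomorphic G H"
  shows "card (edges G) = card (edges H)"
proof -
  obtain f where f: "bij_betw f (verts G) (verts H)"
    and e: "\<forall>u\<in>verts G. \<forall>v\<in>verts G. {u, v} \<in> edges G \<longleftrightarrow> {f u, f v} \<in> edges H"
    using assms(3) unfolding isomorphic_def by blast
  have inj: "inj_on (image f) (edges G)"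
    using f assms(1) unfolding labeled_graph_def bij_betw_def
    by (meson inj_onI inj_on_image_eq_iff)
  have "image f ` edges G = edges H"
  proof (intro equalityI subsetI)
    fix d assume "d \<in> image f ` edges G"
    then obtain c where c: "c \<in> edges G" "d = f ` c" by blast
    obtain u v where "c = {u, v}" "u \<in> verts G" "v \<in> verts G"
      using edge_endpoints[OF assms(1) c(1)] .
    with c e show "d \<in> edges H" by auto
  next
    fix d assume d: "d \<in> edges H"
    obtain a b where ab: "d = {a, b}" "a \<in> verts H" "b \<in> verts H"
      using edge_endpoints[OF assms(2) d] .
    have "verts H = f ` verts G" using f by (simp add: bij_betw_def)
    then obtain u v where "u \<in> verts G" "v \<in> verts G" "f u = a" "f v = b"
      using ab(2,3) by (metis imageE)
    with ab d e show "d \<in> image f ` edges G" by (intro image_eqI[of _ _ "{u, v}"]) auto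
  qed
  with inj show ?thesis by (metis card_image)
qed

lemma finite_common_subgraph_cards:
  assumes "labeled_graph G1"
  shows "finite {card (edges H) | H. common_subgraph H G1 G2}"
proof (rule finite_subset)
  show "{card (edges H) | H. common_subgraph H G1 G2} \<subseteq> {..card (edges G1)}"
    using finite_edges[OF assms] by (auto simp: common_subgraph_def subgraph_def intro!: card_mono)
qed simp

lemma mces_ge:
  assumes "labeled_graph G1" "common_subgraph H G1 G2"
  shows "card (edges H) \<le> mces G1 G2"
  unfolding mces_def using assms by (intro Max_ge finite_common_subgraph_cards) auto

text \<open>The graph without vertices is always a common subgraph, so the maximum is taken over a
  nonempty set.\<close>

lemma mces_attained:
  fixes G1 :: "('v, 'l) lgraph" and G2 :: "('w, 'l) lgraph"
  assumes "labeled_graph G1"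
  obtains H where "common_subgraph H G1 G2" "card (edges H) = mces G1 G2"
proof -
  let ?S = "{card (edges H) | H. common_subgraph H G1 G2}"
  let ?e1 = "G1\<lparr>verts := {}, edges := {}\<rparr>" and ?e2 = "G2\<lparr>verts := {}, edges := {}\<rparr>"
  have "subgraph ?e1 G1" "subgraph ?e2 G2" "isomorphic ?e1 ?e2"
    by (auto simp: subgraph_def labeled_graph_def isomorphic_def bij_betw_def)
  then have "?S \<noteq> {}" unfolding common_subgraph_def by blast
  then have "Max ?S \<in> ?S" using finite_common_subgraph_cards[OF assms] by (rule Max_in[rotated])
  then show ?thesis using that unfolding mces_def by auto
qed

text \<open>The shared edges, on the vertices common to \<open>G1\<close> and \<open>G'\<close>,
  form a subgraph of \<open>G1\<close>. The isomorphism from \<open>G'\<close> to \<open>G2\<close>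
  carries it to a subgraph of \<open>G2\<close>, and \<open>lab\<close> makes the vertex labels
  agree.\<close>

lemma shared_edges_le_mces:
  assumes G1: "labeled_graph G1" and G': "labeled_graph G'"
    and iso: "isomorphic G' G2" and G2: "labeled_graph G2"
    and lab: "\<And>v. v \<in> verts G1 \<Longrightarrow> v \<in> verts G' \<Longrightarrow> vlab G' v = vlab G1 v"
  shows "card (shared_edges G1 G') \<le> mces G1 G2"
proof -
  obtain f where f: "bij_betw f (verts G') (verts G2)"
    and e: "\<forall>u\<in>verts G'. \<forall>v\<in>verts G'. {u, v} \<in> edges G' \<longleftrightarrow> {f u, f v} \<in> edges G2"
    and vl: "\<forall>v\<in>verts G'. vlab G2 (f v) = vlab G' v"
    and el: "\<forall>e\<in>edges G'. elab G2 (f ` e) = elab G' e"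
    using iso unfolding isomorphic_def by blast
  let ?V = "verts G1 \<inter> verts G'" and ?E = "shared_edges G1 G'"
  define H where "H = G1\<lparr>verts := ?V, edges := ?E\<rparr>"
  define K where "K = G2\<lparr>verts := f ` ?V, edges := image f ` ?E\<rparr>"
  have inj: "inj_on f (verts G')" using f by (simp add: bij_betw_def)
  have E: "c \<subseteq> ?V \<and> card c = 2 \<and> c \<in> edges G1 \<and> c \<in> edges G' \<and> elab G1 c = elab G' c"
    if "c \<in> ?E" for c
    using that G1 G' unfolding shared_edges_def labeled_graph_def by auto
  have H: "subgraph H G1"
    using E G1 by (auto simp: subgraph_def H_def labeled_graph_def)
  have "f ` c \<in> edges G2 \<and> f ` c \<subseteq> f ` ?V \<and> card (f ` c) = 2" if c: "c \<in> ?E" for c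
  proof -
    obtain u v where uv: "c = {u, v}" using E[OF c] by (auto simp: card_2_iff)
    have "card (f ` c) = card c"
      using E[OF c] inj by (intro card_image) (auto intro: inj_on_subset)
    then show ?thesis using E[OF c] e uv by auto
  qed
  then have K: "subgraph K G2"
    using G2 G1 f by (auto simp: subgraph_def K_def labeled_graph_def bij_betw_def)
  have "isomorphic H K"
    unfolding isomorphic_def
  proof (intro exI[of _ f] conjI ballI)
    show "bij_betw f (verts H) (verts K)"
      using inj by (auto simp: H_def K_def bij_betw_def intro: inj_on_subset)
  next
    fix u v assume uv: "u \<in> verts H" "v \<in> verts H"
    have "f ` {u, v} \<in> image f ` ?E \<longleftrightarrow> {u, v} \<in> ?E"
    proof
      assume "f ` {u, v} \<in> image f ` ?E"
      then obtain c where c: "c \<in> ?E" "f ` {u, v} = f ` c" by blast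
      \<comment> \<open>The map \<open>f\<close> is injective only on \<open>verts G'\<close>, so
        both sets must lie there before the image can be cancelled.\<close>
      moreover have "c \<subseteq> verts G'" "{u, v} \<subseteq> verts G'" using E[OF c(1)] uv by (auto simp: H_def)
      ultimately show "{u, v} \<in> ?E" using inj inj_on_image_eq_iff by metis
    qed blast
    then show "{u, v} \<in> edges H \<longleftrightarrow> {f u, f v} \<in> edges K" by (simp add: H_def K_def)
  qed (use vl lab el E in \<open>auto simp: H_def K_def\<close>)
  then have "common_subgraph H G1 G2" using H K unfolding common_subgraph_def by blast
  from mces_ge[OF G1 this] show ?thesis by (simp add: H_def)
qed

lemma path_cost_C_E_ge_mces:
  assumes G1: "labeled_graph G1" and G2: "labeled_graph G2" and p: "restricted_edit_path G1 G2 p"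
  shows "ereal (real (card (edges G1)) + real (card (edges G2)) - 2 * real (mces G1 G2))
    \<le> path_cost C_E G1 p"
proof (cases "path_cost C_E G1 p < \<infinity>")
  case True
  let ?G' = "foldl apply_op G1 p"
  have p': "applicable_path G1 p" "isomorphic ?G' G2" "distinct (map edited p)"
    using p by (auto simp: restricted_edit_path_def)
  have G': "labeled_graph ?G'" using labeled_graph_foldl G1 p' by blast
  have "card (shared_edges G1 ?G') \<le> mces G1 G2"
    using surviving_vertex_label[OF p'(1,3) True]
    by (intro shared_edges_le_mces G1 G2 G' p'(2)) auto
  then have "real (card (edges G1)) + real (card (edges G2)) - 2 * real (mces G1 G2) \<le>
      real (card (sym_diff (lab_edges G1) (lab_edges ?G')))"
    using card_sym_diff_lab_edges[OF G1 G'] isomorphic_card_edges[OF G' G2 p'(2)] by simp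
  then show ?thesis using path_cost_C_E_ge[OF G1 p'(1)] by (meson ereal_less_eq(3) order_trans)
next
  case False
  then have "path_cost C_E G1 p = \<infinity>" by (simp add: less_top[symmetric] top_ereal_def)
  then show ?thesis by simp
qed

section \<open>An optimal path\<close>

text \<open>The sum type is that of \<open>edited\<close>, so an operation can be matched with the
  item it repairs. Vertex labels are left out: their agreement on common vertices is carried along
  as a separate invariant.\<close>

definition discrepancies :: "('v, 'l) lgraph \<Rightarrow> ('v, 'l) lgraph \<Rightarrow> ('v + 'v set) set" where
  "discrepancies A B = Inl ` sym_diff (verts A) (verts B)
     \<union> Inr ` {e. e \<in> sym_diff (edges A) (edges B) \<or> e \<in> edges A \<inter> edges B \<and> elab A e \<noteq> elab B e}"

lemma finite_discrepancies:
  assumes "labeled_graph A" "labeled_graph B"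
  shows "finite (discrepancies A B)"
proof -
  have "discrepancies A B \<subseteq> Inl ` (verts A \<union> verts B) \<union> Inr ` (edges A \<union> edges B)"
    by (auto simp: discrepancies_def)
  then show ?thesis
    by (rule finite_subset) (use assms finite_edges in \<open>auto simp: labeled_graph_def\<close>)
qed

text \<open>The cost equals the decrease of the distance to \<open>B\<close> exactly, so the costs
  telescope along a path of such operations.\<close>

lemma ex_repairing_op:
  assumes A: "labeled_graph A" and B: "labeled_graph B"
    and lab: "\<forall>v\<in>verts A \<inter> verts B. vlab A v = vlab B v"
    and ne: "discrepancies A B \<noteq> {}"
  obtains x where "applicable A x" "edited x \<in> discrepancies A B"
    "discrepancies (apply_op A x) B = discrepancies A B - {edited x}"
    "\<forall>v\<in>verts (apply_op A x) \<inter> verts B. vlab (apply_op A x) v = vlab B v"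
    "op_cost C_E A x + ereal (real (card (sym_diff (lab_edges (apply_op A x)) (lab_edges B))))
      = ereal (real (card (sym_diff (lab_edges A) (lab_edges B))))"
proof -
  have fin: "finite (lab_edges A)" "finite (lab_edges B)"
    using A B finite_lab_edges by auto
  \<comment> \<open>The inclusions fix the order of repairs: vertices are deleted only when no
    surplus edge remains, and edges are inserted only when all vertices of \<open>B\<close> are
    present.\<close>
  have "(\<exists>e. e \<in> edges A - edges B) \<or> (\<exists>e. e \<in> edges A \<inter> edges B \<and> elab A e \<noteq> elab B e)
    \<or> (\<exists>v. v \<in> verts A - verts B \<and> edges A \<subseteq> edges B) \<or> (\<exists>v. v \<in> verts B - verts A)
    \<or> (\<exists>e. e \<in> edges B - edges A \<and> verts B \<subseteq> verts A)" (is ?some)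
  proof (rule ccontr)
    assume none: "\<not> ?some"
    then have EA: "edges A \<subseteq> edges B" and V: "verts B \<subseteq> verts A" by auto
    with none have "edges A = edges B" "verts A = verts B" "\<forall>e\<in>edges A. elab A e = elab B e"
      by auto
    with ne show False by (simp add: discrepancies_def)
  qed
  then consider e where "e \<in> edges A - edges B"
    | e where "e \<in> edges A \<inter> edges B" "elab A e \<noteq> elab B e"
    | v where "v \<in> verts A - verts B" "edges A \<subseteq> edges B"
    | v where "v \<in> verts B - verts A"
    | e where "e \<in> edges B - edges A" "verts B \<subseteq> verts A"
    by (elim disjE exE conjE) simp_all
  then show ?thesis
  proof cases
    case (1 e)
    let ?x = "Del_E e :: ('a, 'b) edit_op"
    have "sym_diff (lab_edges A) (lab_edges B) =
        insert (e, elab A e) (sym_diff (lab_edges (apply_op A ?x)) (lab_edges B))"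
      "(e, elab A e) \<notin> sym_diff (lab_edges (apply_op A ?x)) (lab_edges B)"
      using 1 by (auto simp: mem_lab_edges lab_edges_Del_E simp del: apply_op.simps)
    then have "card (sym_diff (lab_edges A) (lab_edges B)) =
        Suc (card (sym_diff (lab_edges (apply_op A ?x)) (lab_edges B)))"
      using fin by (simp add: lab_edges_Del_E del: apply_op.simps)
    then show ?thesis
      using 1 lab by (intro that[of ?x]) (auto simp: discrepancies_def C_E_def)
  next
    case (2 e)
    let ?x = "Rel_E e (elab B e) :: ('a, 'b) edit_op"
    \<comment> \<open>Two pairs leave the symmetric difference, the wrong one from \<open>A\<close>
      and the missing one from \<open>B\<close>, in accordance with cost 2.\<close>
    have "sym_diff (lab_edges A) (lab_edges B) =
        insert (e, elab A e) (insert (e, elab B e) (sym_diff (lab_edges (apply_op A ?x)) (lab_edges B)))"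
      "(e, elab A e) \<notin> insert (e, elab B e) (sym_diff (lab_edges (apply_op A ?x)) (lab_edges B))"
      "(e, elab B e) \<notin> sym_diff (lab_edges (apply_op A ?x)) (lab_edges B)"
      using 2 by (auto simp: mem_lab_edges lab_edges_Rel_E simp del: apply_op.simps)
    then have "card (sym_diff (lab_edges A) (lab_edges B)) =
        Suc (Suc (card (sym_diff (lab_edges (apply_op A ?x)) (lab_edges B))))"
      using fin 2 by (simp add: lab_edges_Rel_E del: apply_op.simps)
    then show ?thesis
      using 2 lab by (intro that[of ?x]) (auto simp: discrepancies_def C_E_def)
  next
    case (3 v)
    \<comment> \<open>Edges of \<open>B\<close> avoid \<open>v\<close>, and all edges of
      \<open>A\<close> are edges of \<open>B\<close>.\<close>
    have "\<forall>e\<in>edges A. v \<notin> e"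
      using 3 B by (auto simp: labeled_graph_def)
    then show ?thesis
      using 3 lab by (intro that[of "Del_V v"])
        (auto simp: discrepancies_def C_E_def lab_edges_def)
  next
    case (4 v)
    \<comment> \<open>Inserting \<open>v\<close> with its label in \<open>B\<close> keeps the label
      invariant without any relabelling.\<close>
    then show ?thesis
      using lab by (intro that[of "Ins_V v (vlab B v)"])
        (auto simp: discrepancies_def C_E_def lab_edges_def)
  next
    case (5 e)
    let ?x = "Ins_E e (elab B e) :: ('a, 'b) edit_op"
    have "sym_diff (lab_edges A) (lab_edges B) =
        insert (e, elab B e) (sym_diff (lab_edges (apply_op A ?x)) (lab_edges B))"
      "(e, elab B e) \<notin> sym_diff (lab_edges (apply_op A ?x)) (lab_edges B)"
      using 5 by (auto simp: mem_lab_edges lab_edges_Ins_E simp del: apply_op.simps)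
    then have "card (sym_diff (lab_edges A) (lab_edges B)) =
        Suc (card (sym_diff (lab_edges (apply_op A ?x)) (lab_edges B)))"
      using fin 5 by (simp add: lab_edges_Ins_E del: apply_op.simps)
    moreover have "e \<subseteq> verts A" "card e = 2" using 5 B by (auto simp: labeled_graph_def)
    ultimately show ?thesis
      using 5 lab by (intro that[of ?x]) (auto simp: discrepancies_def C_E_def)
  qed
qed

text \<open>Induction on the number of discrepancies. Each operation edits a current discrepancy and
  removes it, so later operations cannot edit the same item; the inclusion in
  \<open>discrepancies A B\<close> yields distinctness in this way.\<close>

lemma ex_repairing_path:
  assumes "labeled_graph A" "labeled_graph B"
    and "\<forall>v\<in>verts A \<inter> verts B. vlab A v = vlab B v"
  shows "\<exists>p. applicable_path A p \<and> distinct (map edited p) \<and> edited ` set p \<subseteq> discrepancies A B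
    \<and> discrepancies (foldl apply_op A p) B = {}
    \<and> (\<forall>v\<in>verts (foldl apply_op A p) \<inter> verts B. vlab (foldl apply_op A p) v = vlab B v)
    \<and> path_cost C_E A p = ereal (real (card (sym_diff (lab_edges A) (lab_edges B))))"
  using assms
proof (induction "card (discrepancies A B)" arbitrary: A rule: less_induct)
  case less
  show ?case
  proof (cases "discrepancies A B = {}")
    case True
    then have "verts A = verts B" "edges A = edges B" "\<forall>e\<in>edges A. elab A e = elab B e"
      by (auto simp: discrepancies_def)
    then have "lab_edges A = lab_edges B" by (auto simp: lab_edges_def)
    with True less.prems show ?thesis by (intro exI[of _ "[]"]) auto
  next
    case False
    obtain x where x: "applicable A x" "edited x \<in> discrepancies A B"
      "discrepancies (apply_op A x) B = discrepancies A B - {edited x}"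
      "\<forall>v\<in>verts (apply_op A x) \<inter> verts B. vlab (apply_op A x) v = vlab B v"
      "op_cost C_E A x + ereal (real (card (sym_diff (lab_edges (apply_op A x)) (lab_edges B))))
        = ereal (real (card (sym_diff (lab_edges A) (lab_edges B))))"
      using ex_repairing_op[OF less.prems False] .
    have "card (discrepancies (apply_op A x) B) < card (discrepancies A B)"
      unfolding x(3) by (rule card_Diff1_less[OF finite_discrepancies[OF less.prems(1,2)] x(2)])
    from less.hyps[OF this labeled_graph_apply_op[OF less.prems(1) x(1)] less.prems(2) x(4)]
    obtain p where p: "applicable_path (apply_op A x) p" "distinct (map edited p)"
      "edited ` set p \<subseteq> discrepancies A B - {edited x}"
      "discrepancies (foldl apply_op (apply_op A x) p) B = {}"
      "\<forall>v\<in>verts (foldl apply_op (apply_op A x) p) \<inter> verts B.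
        vlab (foldl apply_op (apply_op A x) p) v = vlab B v"
      "path_cost C_E (apply_op A x) p =
        ereal (real (card (sym_diff (lab_edges (apply_op A x)) (lab_edges B))))"
      unfolding x(3) by blast
    have "path_cost C_E A (x # p) = ereal (real (card (sym_diff (lab_edges A) (lab_edges B))))"
      using x(5) p(6) by simp
    with x(1,2) p(1-5) show ?thesis by (intro exI[of _ "x # p"]) auto
  qed
qed

text \<open>The copy \<open>G'\<close> of \<open>G2\<close> is its pullback along the given isomorphism from \<open>H\<close>, extended by
  fresh vertices.\<close>

lemma ex_copy_sharing_subgraph:
  fixes G1 :: "('v::infinite, 'l) lgraph" and G2 :: "('w, 'l) lgraph"
  assumes G1: "labeled_graph G1" and G2: "labeled_graph G2" and H: "common_subgraph H G1 G2"
  obtains G' :: "('v, 'l) lgraph" where "labeled_graph G'" "isomorphic G' G2"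
    "\<forall>v\<in>verts G1 \<inter> verts G'. vlab G1 v = vlab G' v" "edges H \<subseteq> shared_edges G1 G'"
proof -
  obtain K where K: "subgraph K G2" and iso: "isomorphic H K" and H1: "subgraph H G1"
    using H unfolding common_subgraph_def by blast
  obtain g where g: "bij_betw g (verts H) (verts K)"
    and ge: "\<forall>u\<in>verts H. \<forall>v\<in>verts H. {u, v} \<in> edges H \<longleftrightarrow> {g u, g v} \<in> edges K"
    and gv: "\<forall>v\<in>verts H. vlab K (g v) = vlab H v"
    and gl: "\<forall>e\<in>edges H. elab K (g ` e) = elab H e"
    using iso unfolding isomorphic_def by blast
  have "infinite (UNIV - verts G1)"
    using G1 by (simp add: labeled_graph_def infinite_UNIV Diff_infinite_finite)
  \<comment> \<open>\<open>X\<close> supplies one fresh vertex for each vertex of \<open>G2\<close>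
    outside \<open>K\<close>.\<close>
  then obtain X where X: "X \<subseteq> UNIV - verts G1" "finite X" "card X = card (verts G2 - verts K)"
    using infinite_arbitrarily_large by metis
  then obtain h where h: "bij_betw h X (verts G2 - verts K)"
    using G2 by (metis finite_Diff finite_same_card_bij labeled_graph_def)
  define F where "F v = (if v \<in> verts H then g v else h v)" for v
  define V where "V = verts H \<union> X"
  have HX: "verts H \<inter> X = {}" "verts H \<subseteq> verts G1" "verts K \<subseteq> verts G2"
    using X H1 K by (auto simp: subgraph_def)
  have "bij_betw F (verts H) (verts K)"
    using g by (rule bij_betw_cong[THEN iffD1, rotated]) (simp add: F_def)
  moreover have "bij_betw F X (verts G2 - verts K)"
    using h by (rule bij_betw_cong[THEN iffD1, rotated]) (use HX in \<open>auto simp: F_def\<close>)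
  ultimately have "bij_betw F V (verts K \<union> (verts G2 - verts K))"
    unfolding V_def by (rule bij_betw_combine) auto
  then have F: "bij_betw F V (verts G2)" using HX by (simp add: Un_absorb1)
  define G' where "G' = \<lparr>verts = V, edges = {e. e \<subseteq> V \<and> F ` e \<in> edges G2},
    vlab = vlab G2 \<circ> F, elab = (\<lambda>e. elab G2 (F ` e))\<rparr>"
  \<comment> \<open>Injectivity of \<open>F\<close> on \<open>V\<close> ensures that pulled-back
    edges have two endpoints.\<close>
  have "card e = 2" if "e \<subseteq> V" "F ` e \<in> edges G2" for e
  proof -
    have "card (F ` e) = card e"
      using F that(1) by (intro card_image) (auto simp: bij_betw_def intro: inj_on_subset)
    then show ?thesis using that(2) G2 by (simp add: labeled_graph_def)
  qed
  moreover have "finite V"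
    using X HX G1 by (auto simp: V_def labeled_graph_def intro: finite_subset)
  ultimately have "labeled_graph G'" by (auto simp: G'_def labeled_graph_def)
  moreover have "isomorphic G' G2"
    unfolding isomorphic_def using F by (intro exI[of _ F]) (simp add: G'_def)
  moreover have "\<forall>v\<in>verts G1 \<inter> verts G'. vlab G1 v = vlab G' v"
  proof
    fix v assume "v \<in> verts G1 \<inter> verts G'"
    \<comment> \<open>The fresh vertices avoid \<open>G1\<close>, so vertices common to
      \<open>G1\<close> and \<open>G'\<close> come from \<open>H\<close>, where \<open>F\<close> is
      the label-preserving map \<open>g\<close>.\<close>
    then have v: "v \<in> verts H" using X by (auto simp: G'_def V_def)
    then have "g v \<in> verts K" using g by (auto simp: bij_betw_def)
    then have "vlab K (g v) = vlab G2 (g v)" using K by (simp add: subgraph_def)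
    moreover have "vlab H v = vlab G1 v" using v H1 by (simp add: subgraph_def)
    ultimately show "vlab G1 v = vlab G' v" using v gv by (simp add: G'_def F_def)
  qed
  \<comment> \<open>Since \<open>K\<close> need not be induced, \<open>G'\<close> may have further
    edges on \<open>verts H\<close>, and for arbitrary \<open>H\<close> only an inclusion can be
    expected.\<close>
  moreover have "edges H \<subseteq> shared_edges G1 G'"
  proof
    fix e assume e: "e \<in> edges H"
    have "labeled_graph H" using H1 by (simp add: subgraph_def)
    then obtain u v where uv: "e = {u, v}" "u \<in> verts H" "v \<in> verts H"
      using e by (rule edge_endpoints)
    have Fe: "F ` e = g ` e" using uv by (simp add: F_def)
    have "g ` e \<in> edges K" using e uv ge by auto
    then have "g ` e \<in> edges G2" "elab G2 (g ` e) = elab H e"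
      using K gl e by (auto simp: subgraph_def)
    then show "e \<in> shared_edges G1 G'"
      using e uv Fe H1 by (auto simp: shared_edges_def G'_def V_def subgraph_def)
  qed
  ultimately show ?thesis by (rule that)
qed

text \<open>The end of a repairing path may still differ from its target in label values outside the
  graph, so isomorphism is transferred instead of deriving equality.\<close>

lemma isomorphic_if_no_discrepancies:
  assumes "discrepancies A B = {}" "\<forall>v\<in>verts A \<inter> verts B. vlab A v = vlab B v" "isomorphic B G"
  shows "isomorphic A G"
proof -
  have "verts A = verts B" "edges A = edges B" "\<forall>e\<in>edges B. elab A e = elab B e"
    using assms(1) by (auto simp: discrepancies_def)
  then show ?thesis using assms(2,3) unfolding isomorphic_def by simp
qed

text \<open>A copy of \<open>G2\<close> that contains a maximum common subgraph shares at least
  \<open>mces G1 G2\<close> edges with \<open>G1\<close>, which bounds the cost of repairing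
  \<open>G1\<close> into that copy.\<close>

lemma ex_path_le_mces:
  fixes G1 :: "('v::infinite, 'l) lgraph" and G2 :: "('w, 'l) lgraph"
  assumes G1: "labeled_graph G1" and G2: "labeled_graph G2"
  obtains p where "restricted_edit_path G1 G2 p"
    "path_cost C_E G1 p
      \<le> ereal (real (card (edges G1)) + real (card (edges G2)) - 2 * real (mces G1 G2))"
proof -
  obtain H where H: "common_subgraph H G1 G2" "card (edges H) = mces G1 G2"
    using mces_attained[OF G1] .
  obtain G' :: "('v, 'l) lgraph" where G': "labeled_graph G'" "isomorphic G' G2"
    "\<forall>v\<in>verts G1 \<inter> verts G'. vlab G1 v = vlab G' v" "edges H \<subseteq> shared_edges G1 G'"
    using ex_copy_sharing_subgraph[OF G1 G2 H(1)] .
  obtain p where p: "applicable_path G1 p" "distinct (map edited p)"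
    "discrepancies (foldl apply_op G1 p) G' = {}"
    "\<forall>v\<in>verts (foldl apply_op G1 p) \<inter> verts G'. vlab (foldl apply_op G1 p) v = vlab G' v"
    "path_cost C_E G1 p = ereal (real (card (sym_diff (lab_edges G1) (lab_edges G'))))"
    using ex_repairing_path[OF G1 G'(1,3)] by blast
  have "\<not> (Del_E e \<in> set p \<and> (\<exists>l. Ins_E e l \<in> set p))" for e
  proof
    assume "Del_E e \<in> set p \<and> (\<exists>l. Ins_E e l \<in> set p)"
    then obtain l where l: "Del_E e \<in> set p" "Ins_E e l \<in> set p" by blast
    \<comment> \<open>Deletion and insertion of \<open>e\<close> have the same value under
      \<open>edited\<close>, so injectivity would identify two different operations.\<close>
    have "inj_on edited (set p)" using p(2) by (simp add: distinct_map)
    from inj_onD[OF this _ l] show False by simp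
  qed
  then have "restricted_edit_path G1 G2 p"
    using p isomorphic_if_no_discrepancies[OF p(3,4) G'(2)] by (simp add: restricted_edit_path_def)
  moreover have "mces G1 G2 \<le> card (shared_edges G1 G')"
    unfolding H(2)[symmetric] using G'(4) finite_edges[OF G1]
    by (intro card_mono) (auto simp: shared_edges_def)
  then have "path_cost C_E G1 p
      \<le> ereal (real (card (edges G1)) + real (card (edges G2)) - 2 * real (mces G1 G2))"
    using p(5) card_sym_diff_lab_edges[OF G1 G'(1)] isomorphic_card_edges[OF G'(1) G2 G'(2)]
    by simp
  ultimately show ?thesis by (rule that)
qed

theorem theorem1:
  fixes G1 :: "('v::infinite, 'l::finite) lgraph" and G2 :: "('w, 'l) lgraph"
  assumes "labeled_graph G1" and "labeled_graph G2"
  shows "ged C_E G1 G2 =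
    ereal (real (card (edges G1)) + real (card (edges G2)) - 2 * real (mces G1 G2))"
proof -
  obtain p where "restricted_edit_path G1 G2 p" "path_cost C_E G1 p
      \<le> ereal (real (card (edges G1)) + real (card (edges G2)) - 2 * real (mces G1 G2))"
    using ex_path_le_mces[OF assms] .
  \<comment> \<open>The lower bound also holds for \<open>p\<close>, so its cost equals the claimed
    value and the minimum is attained.\<close>
  then show ?thesis
    unfolding ged_def using path_cost_C_E_ge_mces[OF assms]
    by (intro Least_equality) (blast intro: antisym)+
qed

end
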